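(* Let $\Phi,A,B:\mathbb{R}^2\to\mathbb{R}$ be functions, let $T>0$, $\alpha\in[0,\tfrac12)$, and let $u^0,v^0\in L^1(\mathbb{R})$. Consider a sequence of space steps $h>0$ with $h\to0$ and a corresponding bounded sequence of values $r=r_h>0$. For each such pair $(h,r)$ let $(u_i^n)_{i\in\mathbb{Z},n\ge0}$, $(v_i^n)_{i\in\mathbb{Z},n\ge0}$ be the values produced by the numerical scheme described in the context, with parameters $h,r,\alpha$ and initial data $u^0,v^0$, let $u_h,v_h$ be the associated step functions, and write $\Phi_i^n=\Phi(u_i^n,v_i^n)$. Suppose there exist $\beta,\gamma\in[0,1)$ such that, as $h\to0$ along the sequence, (a) $\dfrac{h}{r}\to0$; (b) $r|\Phi_i^n|\le1$ for all $n\le\frac{T}{rh}$ and all $i\in\mathbb{Z}$; (c) $h^\beta|\Phi_i^n|=O(1)$, uniformly in $n\le\frac{T}{rh}$ and $i\in\mathbb{Z}$; (d) $\sum_{i\in\mathbb{Z}}|u_i^n|h=O(1)$ and $\sum_{i\in\mathbb{Z}}|v_i^n|h=O(1)$, uniformly in $n\le\frac{T}{rh}$; (e) $\sum_{i\in\mathbb{Z}}|A(u_i^n,v_i^n)|h^{1+\gamma}=O(1)$ and $\sum_{i\in\mathbb{Z}}|B(u_i^n,v_i^n)|h^{1+\gamma}=O(1)$, uniformly in $n\le\frac{T}{rh}$. Then for every $\psi\in\mathcal{C}_c^\infty(\mathbb{R}\times(0,T))$, $$\int\left[u_h\psi_t+u_h\Phi(u_h,v_h)\psi_x-A(u_h,v_h)\psi_x\right]dx\,dt\to0,$$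 $$\int\left[v_h\psi_t+v_h\Phi(u_h,v_h)\psi_x-B(u_h,v_h)\psi_x\right]dx\,dt\to0$$ as $h\to0$. More precisely, each of these two integrals is equal to $$O\!\left(\frac hr\right)+O(h^{1-\beta})+O(h^{1-\gamma})$$ as $h\to0$ (the implied constants may depend on $\psi$).
   Context: The scheme approximates the system $u_t+[u\Phi(u,v)]_x=[A(u,v)]_x$, $v_t+[v\Phi(u,v)]_x=[B(u,v)]_x$. Numerical scheme with space step $h>0$, CFL parameter $r>0$, averaging parameter $\alpha\in[0,\frac12)$, and initial data $u^0,v^0\in L^1(\mathbb{R})$. Put $I_i=(ih-\frac h2,ih+\frac h2)$ for $i\in\mathbb{Z}$ and $t_n=nrh$ for integers $n\ge0$. For $a<b$ put $L(a,b)=\max(0,\min(1,b)-\max(0,a))$, i.e. the length of $[0,1]\cap[a,b]$. Initialization: $u_i^0=\frac1h\int_{I_i}u^0\,dx$, $v_i^0=\frac1h\int_{I_i}v^0\,dx$. Given $(u_i^n,v_i^n)_{i\in\mathbb{Z}}$, the values $(u_i^{n+1},v_i^{n+1})_{i\in\mathbb{Z}}$ are defined in three steps. 1. Transport: $\Phi_i^n=\Phi(u_i^n,v_i^n)$ and $$\overline u_i=u_{i-1}^nL(-1+r\Phi_{i-1}^n,r\Phi_{i-1}^n)+u_i^nL(r\Phi_i^n,1+r\Phi_i^n)+u_{i+1}^nL(1+r\Phi_{i+1}^n,2+r\Phi_{i+1}^n),$$ $$\overline v_i=v_{i-1}^nL(-1+r\Phi_{i-1}^n,r\Phi_{i-1}^n)+v_i^nL(r\Phi_i^n,1+r\Phi_i^n)+v_{i+1}^nL(1+r\Phi_{i+1}^n,2+r\Phi_{i+1}^n).$$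 2. Averaging: $\widetilde u_i=\alpha\overline u_{i-1}+(1-2\alpha)\overline u_i+\alpha\overline u_{i+1}$ and $\widetilde v_i=\alpha\overline v_{i-1}+(1-2\alpha)\overline v_i+\alpha\overline v_{i+1}$. 3. Centered discretization: $$u_i^{n+1}=\widetilde u_i+\tfrac r2\left[A(u_{i+1}^n,v_{i+1}^n)-A(u_{i-1}^n,v_{i-1}^n)\right],$$ $$v_i^{n+1}=\widetilde v_i+\tfrac r2\left[B(u_{i+1}^n,v_{i+1}^n)-B(u_{i-1}^n,v_{i-1}^n)\right].$$ The step functions $u_h,v_h$ are defined (almost everywhere) on $\mathbb{R}\times(0,\infty)$ by $u_h(x,t)=u_i^n$ and $v_h(x,t)=v_i^n$ for $(x,t)\in I_i\times(t_n,t_{n+1})$. For a fixed $(h,r)$ the value of $r$ is the same at all time steps. The averaging parameter $\alpha$ is fixed, independent of $h$. *)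

theory Defs
  imports "HOL-Analysis.Analysis" "HOL-Library.Landau_Symbols"
begin

section \<open>Test functions\<close>

text \<open>\<^term>\<open>C_k_diff k f\<close>: the function is of class $C^k$ on the whole (finite-dimensional) space,
  by recursion on all directional derivatives.\<close>

primrec C_k_diff :: "nat \<Rightarrow> ('a::euclidean_space \<Rightarrow> 'b::real_normed_vector) \<Rightarrow> bool" where
  "C_k_diff 0 f \<longleftrightarrow> continuous_on UNIV f"
| "C_k_diff (Suc k) f \<longleftrightarrow>
     (\<forall>z. f differentiable (at z)) \<and> (\<forall>w. C_k_diff k (\<lambda>z. frechet_derivative f (at z) w))"

definition smooth :: "('a::euclidean_space \<Rightarrow> 'b::real_normed_vector) \<Rightarrow> bool" where
  "smooth f \<longleftrightarrow> (\<forall>k. C_k_diff k f)"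

text \<open>For open \<open>\<Omega>\<close> this is $C_c^\infty(\Omega)$, each function being extended by zero outside \<open>\<Omega>\<close>.\<close>

definition test_functions :: "'a::euclidean_space set \<Rightarrow> ('a \<Rightarrow> real) set" where
  "test_functions \<Omega> =
     {\<psi>. smooth \<psi> \<and> compact (closure {z. \<psi> z \<noteq> 0}) \<and> closure {z. \<psi> z \<noteq> 0} \<subseteq> \<Omega>}"

definition partial_x :: "(real \<times> real \<Rightarrow> real) \<Rightarrow> real \<times> real \<Rightarrow> real" where
  "partial_x \<psi> = (\<lambda>(x, t). deriv (\<lambda>y. \<psi> (y, t)) x)"

definition partial_t :: "(real \<times> real \<Rightarrow> real) \<Rightarrow> real \<times> real \<Rightarrow> real" where
  "partial_t \<psi> = (\<lambda>(x, t). deriv (\<lambda>s. \<psi> (x, s)) t)"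


section \<open>The numerical scheme\<close>

definition L :: "real \<Rightarrow> real \<Rightarrow> real" where
  "L a b = max 0 (min 1 b - max 0 a)"

definition cell :: "real \<Rightarrow> int \<Rightarrow> real set" where
  "cell h i = {of_int i * h - h/2 <..< of_int i * h + h/2}"

definition cell_average :: "real \<Rightarrow> (real \<Rightarrow> real) \<Rightarrow> int \<Rightarrow> real" where
  "cell_average h w i = 1/h * (LINT x:cell h i|lebesgue. w x)"

definition transport :: "real \<Rightarrow> (int \<Rightarrow> real) \<Rightarrow> (int \<Rightarrow> real) \<Rightarrow> int \<Rightarrow> real" where
  "transport r \<phi> w i =
      w (i - 1) * L (-1 + r * \<phi> (i - 1)) (r * \<phi> (i - 1))
    + w i * L (r * \<phi> i) (1 + r * \<phi> i)
    + w (i + 1) * L (1 + r * \<phi> (i + 1)) (2 + r * \<phi> (i + 1))"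

definition averaging :: "real \<Rightarrow> (int \<Rightarrow> real) \<Rightarrow> int \<Rightarrow> real" where
  "averaging \<alpha> w i = \<alpha> * w (i - 1) + (1 - 2 * \<alpha>) * w i + \<alpha> * w (i + 1)"

definition scheme_step ::
  "real \<Rightarrow> real \<Rightarrow> (real \<times> real \<Rightarrow> real) \<Rightarrow> (real \<times> real \<Rightarrow> real) \<Rightarrow> (real \<times> real \<Rightarrow> real)
    \<Rightarrow> (int \<Rightarrow> real) \<times> (int \<Rightarrow> real) \<Rightarrow> (int \<Rightarrow> real) \<times> (int \<Rightarrow> real)" where
  "scheme_step r \<alpha> \<Phi> A B = (\<lambda>(u, v).
     let \<phi> = (\<lambda>i. \<Phi> (u i, v i)) in
      (\<lambda>i. averaging \<alpha> (transport r \<phi> u) i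
             + r/2 * (A (u (i + 1), v (i + 1)) - A (u (i - 1), v (i - 1))),
       \<lambda>i. averaging \<alpha> (transport r \<phi> v) i
             + r/2 * (B (u (i + 1), v (i + 1)) - B (u (i - 1), v (i - 1)))))"

primrec scheme ::
  "real \<Rightarrow> real \<Rightarrow> real \<Rightarrow> (real \<times> real \<Rightarrow> real) \<Rightarrow> (real \<times> real \<Rightarrow> real) \<Rightarrow> (real \<times> real \<Rightarrow> real)
    \<Rightarrow> (real \<Rightarrow> real) \<Rightarrow> (real \<Rightarrow> real) \<Rightarrow> nat \<Rightarrow> (int \<Rightarrow> real) \<times> (int \<Rightarrow> real)" where
  "scheme h r \<alpha> \<Phi> A B u0 v0 0 = (cell_average h u0, cell_average h v0)"
| "scheme h r \<alpha> \<Phi> A B u0 v0 (Suc n) =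
     scheme_step r \<alpha> \<Phi> A B (scheme h r \<alpha> \<Phi> A B u0 v0 n)"

text \<open>The step function with value \<open>w n i\<close> on \<open>cell h i \<times> {t\<^sub>n<..<t\<^sub>n\<^sub>+\<^sub>1}\<close>, where \<open>t\<^sub>n = n r h\<close>. The floors
  also give it values on the cell boundaries, a null set.\<close>

definition step_function :: "real \<Rightarrow> real \<Rightarrow> (nat \<Rightarrow> int \<Rightarrow> real) \<Rightarrow> real \<times> real \<Rightarrow> real" where
  "step_function h r w = (\<lambda>(x, t). w (nat \<lfloor>t / (r * h)\<rfloor>) \<lfloor>x / h + 1/2\<rfloor>)"

lemma step_function_eq:
  assumes "h > 0" "r > 0" "x \<in> cell h i" "t \<in> {real n * r * h <..< real (Suc n) * r * h}"
  shows "step_function h r w (x, t) = w n i"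
proof -
  have "\<lfloor>x / h + 1/2\<rfloor> = i"
    using assms(1,3) by (intro floor_unique) (auto simp: cell_def field_simps)
  moreover have "\<lfloor>t / (r * h)\<rfloor> = int n"
    using assms(1,2,4) by (intro floor_unique) (auto simp: field_simps)
  ultimately show ?thesis
    by (simp add: step_function_def)
qed


section \<open>Weak form\<close>

text \<open>The weak form of $w_t + (w\varphi)_x = g_x$ on the strip $0 < t < T$, tested against \<open>\<psi>\<close>.\<close>

definition weak_form ::
  "real \<Rightarrow> (real \<times> real \<Rightarrow> real) \<Rightarrow> (real \<times> real \<Rightarrow> real) \<Rightarrow> (real \<times> real \<Rightarrow> real)
    \<Rightarrow> (real \<times> real \<Rightarrow> real) \<Rightarrow> real" where
  "weak_form T w \<phi> g \<psi> =
     (LINT z:UNIV \<times> {0<..<T}|lebesgue.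
        w z * partial_t \<psi> z + w z * \<phi> z * partial_x \<psi> z - g z * partial_x \<psi> z)"

end

theory Submission
  imports Defs
begin

text \<open>
  The two equations have the same shape: the unknown \<open>w\<close> is transported with velocity \<open>\<phi>\<close>, averaged,
  and receives the centred difference of a source \<open>g\<close>. Nothing couples them in the estimate, so the
  theorem reduces to a statement about arbitrary arrays \<open>w\<close>, \<open>\<phi>\<close>, \<open>g\<close> (\<open>scheme_residual\<close>).

  Consistency is proved by duality, so that only the test function is ever expanded. Let
  \<open>b n i\<close> be the integral of \<open>\<psi>(x, t\<^sub>n)\<close> over the \<open>i\<close>-th cell. On each space-time cell the unknowns are
  constant, so the weak form is a finite sum of cell values times integrals of \<open>\<psi>\<^sub>t\<close> and
  \<open>\<psi>\<^sub>x\<close> (\<open>weak_form_eq_sum\<close>). The integral of \<open>\<psi>\<^sub>t\<close> is exactly \<open>b (n + 1) i - b n i\<close>, and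
  summation by parts in time turns this part into minus the sum of \<open>(w (n + 1) i - w n i) * b (n + 1) i\<close>;
  the end terms vanish since \<open>\<psi>\<close> does for \<open>t \<le> 0\<close> and \<open>t \<ge> T\<close>. Inserting the scheme and passing to
  adjoints (\<open>scheme_step_pairing\<close>) yields differences of \<open>b\<close>: an upwind difference multiplied by \<open>w \<phi>\<close>,
  a centred one multiplied by \<open>g\<close>, and the second difference from averaging multiplied by \<open>w\<close>.

  The first two match the integrals of \<open>\<psi>\<^sub>x\<close> up to \<open>O(r h\<^sup>3)\<close> per cell
  (\<open>flux_consistent\<close>), and the third is \<open>O(h\<^sup>3)\<close> (\<open>averaging_cell_mass\<close>). Summing over \<open>i\<close> with the
  bounds on \<open>w\<close>, \<open>\<phi>\<close> and \<open>g\<close>, and over the \<open>O(1/(r h))\<close> time steps, gives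
  \<open>O(h\<^sup>1\<^sup>-\<^sup>\<beta>) + O(h\<^sup>1\<^sup>-\<^sup>\<gamma>)\<close> from the first two and \<open>O(h/r)\<close> from the third.
\<close>

section \<open>Discrete adjoints\<close>

text \<open>Finite windows with vanishing summands near the ends replace sums over all of \<open>\<int>\<close>, which avoids
  summability conditions for the unknowns.\<close>

lemma sum_shift_int:
  fixes f :: "int \<Rightarrow> real" and K :: int
  assumes "\<And>i. K \<le> \<bar>i\<bar> \<Longrightarrow> f i = 0"
  shows "(\<Sum>i\<in>{-K..K}. f (i + 1)) = (\<Sum>i\<in>{-K..K}. f i)"
proof -
  have "(\<Sum>i\<in>{-K..K}. f (i + 1)) = (\<Sum>i\<in>{-K+1..K+1}. f i)"
    by (rule sum.reindex_bij_witness[of _ "\<lambda>i. i - 1" "\<lambda>i. i + 1"]) auto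
  also have "\<dots> = (\<Sum>i\<in>{-K..K}. f i)"
    by (rule sum.mono_neutral_cong) (auto intro!: assms)
  finally show ?thesis .
qed

lemma sum_shift_mult:
  fixes a b :: "int \<Rightarrow> real" and K :: int
  assumes "\<And>i. K - 1 \<le> \<bar>i\<bar> \<Longrightarrow> b i = 0"
  shows "(\<Sum>i\<in>{-K..K}. a (i - 1) * b i) = (\<Sum>i\<in>{-K..K}. a i * b (i + 1))"
    and "(\<Sum>i\<in>{-K..K}. a (i + 1) * b i) = (\<Sum>i\<in>{-K..K}. a i * b (i - 1))"
proof -
  show "(\<Sum>i\<in>{-K..K}. a (i - 1) * b i) = (\<Sum>i\<in>{-K..K}. a i * b (i + 1))"
    using sum_shift_int[of K "\<lambda>i. a (i - 1) * b i"] assms by simp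
  show "(\<Sum>i\<in>{-K..K}. a (i + 1) * b i) = (\<Sum>i\<in>{-K..K}. a i * b (i - 1))"
    using sum_shift_int[of K "\<lambda>i. a i * b (i - 1)"] assms by simp
qed

lemma averaging_self_adjoint:
  fixes K :: int
  assumes "\<And>i. K - 1 \<le> \<bar>i\<bar> \<Longrightarrow> b i = 0"
  shows "(\<Sum>i\<in>{-K..K}. averaging \<alpha> w i * b i) = (\<Sum>i\<in>{-K..K}. w i * averaging \<alpha> b i)"
proof -
  have "(\<Sum>i\<in>{-K..K}. averaging \<alpha> w i * b i)
      = \<alpha> * (\<Sum>i\<in>{-K..K}. w (i - 1) * b i) + (1 - 2 * \<alpha>) * (\<Sum>i\<in>{-K..K}. w i * b i)
        + \<alpha> * (\<Sum>i\<in>{-K..K}. w (i + 1) * b i)"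
    unfolding sum_distrib_left sum.distrib[symmetric]
    by (intro sum.cong refl) (simp add: averaging_def algebra_simps)
  also have "\<dots> = \<alpha> * (\<Sum>i\<in>{-K..K}. w i * b (i + 1)) + (1 - 2 * \<alpha>) * (\<Sum>i\<in>{-K..K}. w i * b i)
        + \<alpha> * (\<Sum>i\<in>{-K..K}. w i * b (i - 1))"
    using sum_shift_mult[of K b w] assms by simp
  also have "\<dots> = (\<Sum>i\<in>{-K..K}. w i * averaging \<alpha> b i)"
    unfolding sum_distrib_left sum.distrib[symmetric]
    by (intro sum.cong refl) (simp add: averaging_def algebra_simps)
  finally show ?thesis .
qed

text \<open>Each branch is used only as a factor of \<open>\<phi> i\<close>, so the choice made for \<open>\<phi> i = 0\<close> is immaterial.\<close>

definition upwind_diff :: "(int \<Rightarrow> real) \<Rightarrow> (int \<Rightarrow> real) \<Rightarrow> int \<Rightarrow> real" where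
  "upwind_diff \<phi> b i = (if 0 \<le> \<phi> i then b (i + 1) - b i else b i - b (i - 1))"

text \<open>The CFL bound makes the overlap lengths \<open>L\<close> equal to the positive part of \<open>r \<phi>\<close> (mass
  leaving to the right), \<open>1 - r \<bar>\<phi>\<bar>\<close> (mass staying) and the negative part (mass leaving to
  the left). A test sequence therefore sees the mass \<open>w i\<close> moved along \<open>\<phi> i\<close>, which produces the
  difference of \<open>b\<close> taken on the side towards which \<open>\<phi> i\<close> points.\<close>

lemma transport_adjoint:
  fixes K :: int
  assumes supp: "\<And>i. K - 1 \<le> \<bar>i\<bar> \<Longrightarrow> b i = 0" and r: "r > 0" and cfl: "\<And>i. r * \<bar>\<phi> i\<bar> \<le> 1"
  shows "(\<Sum>i\<in>{-K..K}. transport r \<phi> w i * b i)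
       = (\<Sum>i\<in>{-K..K}. w i * (b i + r * \<phi> i * upwind_diff \<phi> b i))"
proof -
  define p where "p i = w i * L (-1 + r * \<phi> i) (r * \<phi> i)" for i
  define q where "q i = w i * L (r * \<phi> i) (1 + r * \<phi> i)" for i
  define m where "m i = w i * L (1 + r * \<phi> i) (2 + r * \<phi> i)" for i
  have "(\<Sum>i\<in>{-K..K}. transport r \<phi> w i * b i)
      = (\<Sum>i\<in>{-K..K}. p (i - 1) * b i) + (\<Sum>i\<in>{-K..K}. q i * b i) + (\<Sum>i\<in>{-K..K}. m (i + 1) * b i)"
    by (simp add: transport_def p_def q_def m_def sum.distrib algebra_simps)
  also have "\<dots> = (\<Sum>i\<in>{-K..K}. p i * b (i + 1) + q i * b i + m i * b (i - 1))"
    using sum_shift_mult[of K b p] sum_shift_mult[of K b m] supp by (simp add: sum.distrib)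
  also have "\<dots> = (\<Sum>i\<in>{-K..K}. w i * (b i + r * \<phi> i * upwind_diff \<phi> b i))"
  proof (rule sum.cong[OF refl])
    fix i
    have "\<bar>r * \<phi> i\<bar> \<le> 1"
      using cfl[of i] r by (simp add: abs_mult)
    moreover have "0 \<le> \<phi> i \<longleftrightarrow> 0 \<le> r * \<phi> i"
      using r by (simp add: zero_le_mult_iff)
    ultimately show "p i * b (i + 1) + q i * b i + m i * b (i - 1)
        = w i * (b i + r * \<phi> i * upwind_diff \<phi> b i)"
      by (auto simp: p_def q_def m_def L_def upwind_diff_def abs_if min_def max_def algebra_simps
          split: if_splits)
  qed
  finally show ?thesis .
qed

text \<open>One time step in weak form. All differences are moved from the unknowns, about whose regularity
  nothing is known, to the test sequence \<open>b\<close>. The margin of two indices in the support condition lets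
  \<open>averaging \<alpha> b\<close> vanish one index before the end of the summation range, so that no boundary
  terms appear.\<close>

lemma scheme_step_pairing:
  fixes K :: int
  assumes supp: "\<And>i. K - 2 \<le> \<bar>i\<bar> \<Longrightarrow> b i = 0" and r: "r > 0" and cfl: "\<And>i. r * \<bar>\<phi> i\<bar> \<le> 1"
    and w': "\<And>i. w' i = averaging \<alpha> (transport r \<phi> w) i + r / 2 * (g (i + 1) - g (i - 1))"
  shows "(\<Sum>i\<in>{-K..K}. (w' i - w i) * b i)
       = (\<Sum>i\<in>{-K..K}. w i * (averaging \<alpha> b i - b i)
            + w i * \<phi> i * (r * upwind_diff \<phi> (averaging \<alpha> b) i)
            - g i * (r / 2 * (b (i + 1) - b (i - 1))))"
proof -
  have supp1: "b i = 0" if "K - 1 \<le> \<bar>i\<bar>" for i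
    using that by (intro supp) simp
  have supp2: "averaging \<alpha> b i = 0" if "K - 1 \<le> \<bar>i\<bar>" for i
  proof -
    have "b (i - 1) = 0" "b i = 0" "b (i + 1) = 0"
      using that by (auto intro!: supp)
    then show ?thesis
      by (simp add: averaging_def)
  qed
  have "(\<Sum>i\<in>{-K..K}. (w' i - w i) * b i)
      = (\<Sum>i\<in>{-K..K}. averaging \<alpha> (transport r \<phi> w) i * b i)
        + r / 2 * ((\<Sum>i\<in>{-K..K}. g (i + 1) * b i) - (\<Sum>i\<in>{-K..K}. g (i - 1) * b i))
        - (\<Sum>i\<in>{-K..K}. w i * b i)"
    by (simp add: w' sum.distrib sum_distrib_left sum_subtractf algebra_simps)
  also have "\<dots> = (\<Sum>i\<in>{-K..K}. w i * (averaging \<alpha> b i + r * \<phi> i * upwind_diff \<phi> (averaging \<alpha> b) i))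
        + r / 2 * ((\<Sum>i\<in>{-K..K}. g i * b (i - 1)) - (\<Sum>i\<in>{-K..K}. g i * b (i + 1)))
        - (\<Sum>i\<in>{-K..K}. w i * b i)"
    by (simp add: averaging_self_adjoint[OF supp1] transport_adjoint[OF supp2 r cfl]
        sum_shift_mult[where a = g and b = b and K = K, OF supp1])
  also have "\<dots> = (\<Sum>i\<in>{-K..K}. w i * (averaging \<alpha> b i - b i)
            + w i * \<phi> i * (r * upwind_diff \<phi> (averaging \<alpha> b) i)
            - g i * (r / 2 * (b (i + 1) - b (i - 1))))"
    by (simp add: sum.distrib sum_distrib_left sum_subtractf algebra_simps)
  finally show ?thesis .
qed

lemma summation_by_parts:
  fixes w b :: "nat \<Rightarrow> int \<Rightarrow> real"
  assumes "\<And>i. b 0 i = 0" "\<And>i. b N i = 0"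
  shows "(\<Sum>n<N. \<Sum>i\<in>S. w n i * (b (Suc n) i - b n i))
       = - (\<Sum>n<N. \<Sum>i\<in>S. (w (Suc n) i - w n i) * b (Suc n) i)"
proof -
  define a where "a n = (\<Sum>i\<in>S. w n i * b n i)" for n
  have "(\<Sum>n<N. \<Sum>i\<in>S. w n i * (b (Suc n) i - b n i))
      + (\<Sum>n<N. \<Sum>i\<in>S. (w (Suc n) i - w n i) * b (Suc n) i) = (\<Sum>n<N. a (Suc n) - a n)"
    unfolding a_def sum.distrib[symmetric] sum_subtractf[symmetric]
    by (intro sum.cong refl) (simp add: algebra_simps)
  also have "\<dots> = a N - a 0"
    by (rule sum_lessThan_telescope)
  also have "\<dots> = 0"
    by (simp add: a_def assms)
  finally show ?thesis
    by simp
qed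

section \<open>Integrals over cells\<close>

lemma integral_close_to_const:
  fixes f :: "'a::euclidean_space \<Rightarrow> real"
  assumes "continuous_on (cbox a b) f" and "\<And>z. z \<in> cbox a b \<Longrightarrow> \<bar>f z - d\<bar> \<le> e" and "0 \<le> e"
  shows "\<bar>integral (cbox a b) f - measure lborel (cbox a b) * d\<bar> \<le> e * measure lborel (cbox a b)"
proof -
  have "((\<lambda>z. f z - d) has_integral integral (cbox a b) f - measure lborel (cbox a b) *\<^sub>R d) (cbox a b)"
    by (intro has_integral_diff has_integral_const integrable_integral integrable_continuous assms)
  then show ?thesis
    using has_integral_bound[of e "\<lambda>z. f z - d"] assms by simp
qed

text \<open>Half-open boxes tile the half plane without overlaps, as do the level sets of the floors in
  \<open>step_function\<close>. This lemma passes from them to closed boxes, where Fubini's theorem and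
  the fundamental theorem of calculus are stated.\<close>

lemma half_open_box_integral:
  fixes f :: "real \<times> real \<Rightarrow> real"
  assumes "continuous_on UNIV f"
  shows "integrable lebesgue (\<lambda>z. indicator ({a..<b} \<times> {c..<d}) z * f z)"
    and "(LINT z|lebesgue. indicator ({a..<b} \<times> {c..<d}) z * f z) = integral (cbox (a, c) (b, d)) f"
proof -
  let ?Q = "{a..<b} \<times> {c..<d}"
  have sub: "box (a, c) (b, d) \<subseteq> ?Q" "?Q \<subseteq> cbox (a, c) (b, d)"
    by (auto simp: box_def cbox_def Basis_prod_def)
  have "f absolutely_integrable_on cbox (a, c) (b, d)"
    using assms by (intro absolutely_integrable_continuous continuous_on_subset[OF assms]) auto
  moreover have "?Q \<in> sets lebesgue"
    by (intro sets_completionI_sets) (simp add: borel_Times)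
  ultimately have int: "set_integrable lebesgue ?Q f"
    using sub(2) by (rule set_integrable_subset)
  show "integrable lebesgue (\<lambda>z. indicator ?Q z * f z)"
    using int by (simp add: set_integrable_def)
  have "(LINT z|lebesgue. indicator ?Q z * f z) = integral ?Q f"
    using set_lebesgue_integral_eq_integral(2)[OF int] by (simp add: set_lebesgue_integral_def)
  also have "\<dots> = integral (cbox (a, c) (b, d)) f"
  proof (rule integral_spike_set)
    show "negligible {x \<in> ?Q - cbox (a, c) (b, d). f x \<noteq> 0}"
      using sub(2) by (intro negligible_subset[OF negligible_empty]) auto
    show "negligible {x \<in> cbox (a, c) (b, d) - ?Q. f x \<noteq> 0}"
      using sub(1) by (intro negligible_subset[OF negligible_frontier_interval]) auto
  qed
  finally show "(LINT z|lebesgue. indicator ?Q z * f z) = integral (cbox (a, c) (b, d)) f" .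
qed

text \<open>Exact cell integrals of \<open>\<psi>(x, t)\<close> serve as the discrete test sequence, rather than point values:
  their increments in time are then exactly the integrals of \<open>\<psi>\<^sub>t\<close> over the space-time
  cells, so the time derivative contributes no error at all.\<close>

definition cell_mass :: "(real \<times> real \<Rightarrow> real) \<Rightarrow> real \<Rightarrow> real \<Rightarrow> int \<Rightarrow> real" where
  "cell_mass \<psi> h t i = integral {of_int i * h - h/2..of_int i * h + h/2} (\<lambda>x. \<psi> (x, t))"

definition cell_flux :: "(real \<times> real \<Rightarrow> real) \<Rightarrow> real \<Rightarrow> real \<Rightarrow> nat \<Rightarrow> int \<Rightarrow> real" where
  "cell_flux \<psi> h \<tau> n i =
     integral (cbox (of_int i * h - h/2, real n * \<tau>) (of_int i * h + h/2, real (Suc n) * \<tau>)) (partial_x \<psi>)"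

section \<open>Consistency of the discrete test sequence\<close>

text \<open>The properties of a test function that the estimate uses: first derivatives, a Lipschitz bound
  for the space derivative, which controls all consistency errors, and vanishing outside
  a bounded part of the strip. \<open>partial_x \<psi>\<close> and \<open>partial_t \<psi>\<close> are total operators
  based on \<open>deriv\<close>, hence the explicit derivative conditions.\<close>

locale bump =
  fixes \<psi> :: "real \<times> real \<Rightarrow> real" and \<Lambda> M T :: real
  assumes T_pos: "T > 0"
    and deriv_x: "\<And>x t. ((\<lambda>y. \<psi> (y, t)) has_real_derivative partial_x \<psi> (x, t)) (at x)"
    and deriv_t: "\<And>x t. ((\<lambda>s. \<psi> (x, s)) has_real_derivative partial_t \<psi> (x, t)) (at t)"
    and cont_x: "continuous_on UNIV (partial_x \<psi>)"
    and cont_t: "continuous_on UNIV (partial_t \<psi>)"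
    and lipschitz: "\<And>x t y s. \<bar>partial_x \<psi> (x, t) - partial_x \<psi> (y, s)\<bar> \<le> \<Lambda> * (\<bar>x - y\<bar> + \<bar>t - s\<bar>)"
    and vanish: "\<And>x t. \<bar>x\<bar> \<ge> M \<or> t \<le> 0 \<or> t \<ge> T \<Longrightarrow> \<psi> (x, t) = 0 \<and> partial_x \<psi> (x, t) = 0 \<and> partial_t \<psi> (x, t) = 0"
begin

lemma \<Lambda>_nonneg: "0 \<le> \<Lambda>"
  using lipschitz[of 0 0 1 0] by simp

lemma continuous_slice: "continuous_on S (\<lambda>x. \<psi> (x, t))"
  by (rule DERIV_continuous_on) (rule has_field_derivative_at_within[OF deriv_x])

text \<open>By the mean value theorem \<open>\<psi>(x + h, t) - \<psi>(x, t)\<close> is \<open>h\<close> times a value of \<open>\<psi>\<^sub>x\<close>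
  between \<open>x\<close> and \<open>x + h\<close>; another factor \<open>h\<close> comes from integrating over the cell. Leaving \<open>d\<close> free
  allows comparing neighbouring differences, and the flux, with one common value of \<open>\<psi>\<^sub>x\<close>.\<close>

lemma cell_mass_diff:
  assumes h: "h > 0" and e: "\<And>\<xi>. \<lbrakk>of_int i * h - h/2 \<le> \<xi>; \<xi> \<le> of_int i * h + 3*h/2\<rbrakk> \<Longrightarrow> \<bar>partial_x \<psi> (\<xi>, t) - d\<bar> \<le> e"
  shows "\<bar>cell_mass \<psi> h t (i + 1) - cell_mass \<psi> h t i - h\<^sup>2 * d\<bar> \<le> h\<^sup>2 * e"
proof -
  let ?a = "of_int i * h - h/2" and ?b = "of_int i * h + h/2"
  let ?f = "\<lambda>x. \<psi> (x + h, t) - \<psi> (x, t)"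
  have e0: "0 \<le> e"
    using e[of "of_int i * h"] h by simp
  have c: "continuous_on S (\<lambda>x. \<psi> (x + h, t))" for S
    using continuous_on_compose[of S "\<lambda>x. x + h" "\<lambda>x. \<psi> (x, t)"] continuous_slice
    by (simp add: o_def continuous_intros)
  have "cell_mass \<psi> h t (i + 1) = integral {?a + h..?b + h} (\<lambda>x. \<psi> (x, t))"
    by (simp add: cell_mass_def algebra_simps)
  also have "\<dots> = integral {?a..?b} (\<lambda>x. \<psi> (x + h, t))"
    using integral_shift[of ?a h ?b "\<lambda>x. \<psi> (x, t)"] continuous_slice by (simp add: o_def)
  finally have "cell_mass \<psi> h t (i + 1) - cell_mass \<psi> h t i = integral {?a..?b} ?f"
    unfolding cell_mass_def
    by (subst integral_diff) (auto intro!: integrable_continuous_real c continuous_slice)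
  moreover have "\<bar>integral (cbox ?a ?b) ?f - measure lborel (cbox ?a ?b) * (h * d)\<bar> \<le> (h * e) * measure lborel (cbox ?a ?b)"
  proof (rule integral_close_to_const)
    show "continuous_on (cbox ?a ?b) ?f"
      by (intro continuous_intros c continuous_slice)
    show "0 \<le> h * e"
      using h e0 by simp
    fix x assume x: "x \<in> cbox ?a ?b"
    obtain \<xi> where \<xi>: "x < \<xi>" "\<xi> < x + h" "?f x = (x + h - x) * partial_x \<psi> (\<xi>, t)"
      using MVT2[of x "x + h" "\<lambda>y. \<psi> (y, t)" "\<lambda>y. partial_x \<psi> (y, t)"] deriv_x h by auto
    have "?f x - h * d = h * (partial_x \<psi> (\<xi>, t) - d)"
      using \<xi>(3) by (simp add: algebra_simps)
    then have "\<bar>?f x - h * d\<bar> = h * \<bar>partial_x \<psi> (\<xi>, t) - d\<bar>"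
      using h by (simp add: abs_mult)
    also have "\<dots> \<le> h * e"
      using h x \<xi> by (intro mult_left_mono e) auto
    finally show "\<bar>?f x - h * d\<bar> \<le> h * e" .
  qed
  ultimately show ?thesis
    using h by (simp add: power2_eq_square mult_ac)
qed

lemma cell_mass_second_diff:
  assumes h: "h > 0"
  shows "\<bar>cell_mass \<psi> h t (i + 1) - 2 * cell_mass \<psi> h t i + cell_mass \<psi> h t (i - 1)\<bar> \<le> 4 * \<Lambda> * h^3"
proof -
  let ?d = "partial_x \<psi> (of_int i * h, t)"
  have near: "\<bar>partial_x \<psi> (\<xi>, t) - ?d\<bar> \<le> \<Lambda> * (2 * h)" if "\<bar>\<xi> - of_int i * h\<bar> \<le> 2 * h" for \<xi>
    using lipschitz[of \<xi> t "of_int i * h" t] mult_left_mono[OF that \<Lambda>_nonneg] by simp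
  have "\<bar>cell_mass \<psi> h t (i + 1) - cell_mass \<psi> h t i - h\<^sup>2 * ?d\<bar> \<le> h\<^sup>2 * (\<Lambda> * (2 * h))"
    using h by (intro cell_mass_diff near) auto
  moreover have "\<bar>cell_mass \<psi> h t (i - 1 + 1) - cell_mass \<psi> h t (i - 1) - h\<^sup>2 * ?d\<bar> \<le> h\<^sup>2 * (\<Lambda> * (2 * h))"
    using h by (intro cell_mass_diff near) (auto simp: algebra_simps abs_le_iff)
  ultimately show ?thesis
    by (simp add: power2_eq_square power3_eq_cube algebra_simps)
qed

text \<open>This is the source of the \<open>O(h/r)\<close> term: averaging costs \<open>O(h\<^sup>3)\<close> per cell whatever \<open>r\<close> is,
  and there are about \<open>T/(r h)\<close> time steps.\<close>

lemma averaging_cell_mass: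
  assumes h: "h > 0" and \<alpha>: "0 \<le> \<alpha>" "\<alpha> < 1/2"
  shows "\<bar>averaging \<alpha> (cell_mass \<psi> h t) i - cell_mass \<psi> h t i\<bar> \<le> 2 * \<Lambda> * h^3"
proof -
  have "averaging \<alpha> (cell_mass \<psi> h t) i - cell_mass \<psi> h t i
      = \<alpha> * (cell_mass \<psi> h t (i + 1) - 2 * cell_mass \<psi> h t i + cell_mass \<psi> h t (i - 1))"
    by (simp add: averaging_def algebra_simps)
  then have "\<bar>averaging \<alpha> (cell_mass \<psi> h t) i - cell_mass \<psi> h t i\<bar>
      = \<alpha> * \<bar>cell_mass \<psi> h t (i + 1) - 2 * cell_mass \<psi> h t i + cell_mass \<psi> h t (i - 1)\<bar>"
    using \<alpha> by (simp add: abs_mult)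
  also have "\<dots> \<le> 1/2 * (4 * \<Lambda> * h^3)"
    using \<alpha> by (intro mult_mono cell_mass_second_diff h) auto
  finally show ?thesis by simp
qed

text \<open>The exact flux integral, the upwind difference and the centred difference all equal
  \<open>r h\<^sup>2 \<psi>\<^sub>x\<close> at a nearby point up to \<open>O(r h\<^sup>3)\<close>. Boundedness of \<open>r\<close> enters here, through the
  variation of \<open>\<psi>\<^sub>x\<close> over a time step of length \<open>r h \<le> R h\<close>. The direction of the upwind
  difference does not matter at this order.\<close>

lemma flux_consistent:
  fixes n :: nat
  assumes h: "h > 0" and r: "r > 0" "r \<le> R" and \<alpha>: "0 \<le> \<alpha>" "\<alpha> < 1/2"
  defines "b \<equiv> cell_mass \<psi> h (real (Suc n) * (r * h))"
  shows "\<bar>cell_flux \<psi> h (r * h) n i - r * upwind_diff \<phi> (averaging \<alpha> b) i\<bar> \<le> (7 + 2 * R) * \<Lambda> * r * h^3"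
    and "\<bar>cell_flux \<psi> h (r * h) n i - r / 2 * (b (i + 1) - b (i - 1))\<bar> \<le> (7 + 2 * R) * \<Lambda> * r * h^3"
proof -
  define \<tau> where "\<tau> = r * h"
  define t where "t = real (Suc n) * \<tau>"
  \<comment> \<open>The common reference value to which the flux and all differences are compared.\<close>
  define d where "d = partial_x \<psi> (of_int i * h, real n * \<tau>)"
  define X where "X = cell_flux \<psi> h \<tau> n i"
  have \<tau>: "0 < \<tau>" "\<tau> \<le> R * h"
    using h r by (auto simp: \<tau>_def)
  have near: "\<bar>partial_x \<psi> (\<xi>, s) - d\<bar> \<le> \<Lambda> * (c + \<tau>)"
    if "\<bar>\<xi> - of_int i * h\<bar> \<le> c" "real n * \<tau> \<le> s" "s \<le> real (Suc n) * \<tau>" for \<xi> s c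
  proof -
    have "\<bar>s - real n * \<tau>\<bar> \<le> \<tau>"
      using that by (simp add: algebra_simps)
    then have "\<Lambda> * (\<bar>\<xi> - of_int i * h\<bar> + \<bar>s - real n * \<tau>\<bar>) \<le> \<Lambda> * (c + \<tau>)"
      using that by (intro mult_left_mono add_mono \<Lambda>_nonneg)
    then show ?thesis
      using lipschitz[of \<xi> s "of_int i * h" "real n * \<tau>"] by (simp add: d_def)
  qed
  have t: "real n * \<tau> \<le> t" "t \<le> real (Suc n) * \<tau>"
    using \<tau> by (auto simp: t_def algebra_simps)
  have b: "b j = cell_mass \<psi> h t j" for j
    by (simp add: b_def t_def \<tau>_def)
  let ?C = "cbox (of_int i * h - h/2, real n * \<tau>) (of_int i * h + h/2, real (Suc n) * \<tau>)"
  have cont: "measure lborel ?C = h * \<tau>"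
    using h \<tau> unfolding content_Pair by (simp add: algebra_simps)
  have "\<bar>X - measure lborel ?C * d\<bar> \<le> (\<Lambda> * (h + \<tau>)) * measure lborel ?C"
    unfolding X_def cell_flux_def
  proof (rule integral_close_to_const)
    show "continuous_on ?C (partial_x \<psi>)"
      using cont_x continuous_on_subset by blast
    show "0 \<le> \<Lambda> * (h + \<tau>)"
      using h \<tau> \<Lambda>_nonneg by simp
    fix z assume z: "z \<in> ?C"
    obtain x s where xs: "z = (x, s)"
      by (cases z)
    show "\<bar>partial_x \<psi> z - d\<bar> \<le> \<Lambda> * (h + \<tau>)"
      unfolding xs using h z by (intro near) (auto simp: xs cbox_Pair_eq abs_le_iff)
  qed
  then have X: "\<bar>X - r * (h\<^sup>2 * d)\<bar> \<le> r * (h\<^sup>2 * (\<Lambda> * (h + \<tau>)))"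
    unfolding cont by (simp add: \<tau>_def power2_eq_square mult_ac)
  have up: "\<bar>b (i + 1) - b i - h\<^sup>2 * d\<bar> \<le> h\<^sup>2 * (\<Lambda> * (2 * h + \<tau>))"
    unfolding b using h t by (intro cell_mass_diff near) auto
  have down: "\<bar>b i - b (i - 1) - h\<^sup>2 * d\<bar> \<le> h\<^sup>2 * (\<Lambda> * (2 * h + \<tau>))"
  proof -
    have "\<bar>cell_mass \<psi> h t (i - 1 + 1) - cell_mass \<psi> h t (i - 1) - h\<^sup>2 * d\<bar> \<le> h\<^sup>2 * (\<Lambda> * (2 * h + \<tau>))"
      using h t by (intro cell_mass_diff near) (auto simp: algebra_simps abs_le_iff)
    then show ?thesis
      by (simp add: b)
  qed
  have av: "\<bar>averaging \<alpha> b j - b j\<bar> \<le> h\<^sup>2 * (\<Lambda> * (2 * h))" for j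
    using averaging_cell_mass[OF h \<alpha>, of t j] 
    by (simp add: b_def t_def \<tau>_def power2_eq_square power3_eq_cube mult_ac)
  have fin: "\<bar>X - r * D\<bar> \<le> (7 + 2 * R) * \<Lambda> * r * h^3"
    if D: "\<bar>D - h\<^sup>2 * d\<bar> \<le> h\<^sup>2 * (\<Lambda> * (6 * h + \<tau>))" for D
  proof -
    have "\<bar>r * (D - h\<^sup>2 * d)\<bar> \<le> r * (h\<^sup>2 * (\<Lambda> * (6 * h + \<tau>)))"
      using D r by (simp add: abs_mult)
    then have "\<bar>X - r * D\<bar> \<le> r * (h\<^sup>2 * (\<Lambda> * (h + \<tau>))) + r * (h\<^sup>2 * (\<Lambda> * (6 * h + \<tau>)))"
      using X by (simp add: right_diff_distrib)
    also have "\<dots> = r * (h\<^sup>2 * (\<Lambda> * (7 * h + 2 * \<tau>)))"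
      by (simp add: algebra_simps)
    also have "\<dots> \<le> r * (h\<^sup>2 * (\<Lambda> * (7 * h + 2 * (R * h))))"
      using r \<tau> \<Lambda>_nonneg by (intro mult_left_mono add_mono) auto
    finally show ?thesis
      by (simp add: power2_eq_square power3_eq_cube algebra_simps)
  qed
  \<comment> \<open>One error from the plain difference of \<open>b\<close> and two from averaging its two entries.\<close>
  have six: "h\<^sup>2 * (\<Lambda> * (6 * h + \<tau>)) = h\<^sup>2 * (\<Lambda> * (2 * h + \<tau>)) + h\<^sup>2 * (\<Lambda> * (2 * h)) + h\<^sup>2 * (\<Lambda> * (2 * h))"
    by (simp add: algebra_simps)
  have "\<bar>upwind_diff \<phi> (averaging \<alpha> b) i - h\<^sup>2 * d\<bar> \<le> h\<^sup>2 * (\<Lambda> * (6 * h + \<tau>))"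
    using up down av[of i] av[of "i + 1"] av[of "i - 1"]
    unfolding six upwind_diff_def abs_le_iff
    by (cases "0 \<le> \<phi> i") (simp_all only: if_True if_False, linarith+)
  from fin[OF this] show "\<bar>cell_flux \<psi> h (r * h) n i - r * upwind_diff \<phi> (averaging \<alpha> b) i\<bar> \<le> (7 + 2 * R) * \<Lambda> * r * h^3"
    by (simp add: X_def \<tau>_def)
  have mean_close: "\<bar>(p + q) / 2 - s\<bar> \<le> e + f + f"
    if "\<bar>p - s\<bar> \<le> e" "\<bar>q - s\<bar> \<le> e" "0 \<le> f" for p q s e f :: real
    using that by (auto simp: abs_le_iff field_simps)
  have "0 \<le> h\<^sup>2 * (\<Lambda> * (2 * h))"
    using h \<Lambda>_nonneg by simp
  with up down have "\<bar>((b (i + 1) - b i) + (b i - b (i - 1))) / 2 - h\<^sup>2 * d\<bar> \<le> h\<^sup>2 * (\<Lambda> * (6 * h + \<tau>))"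
    unfolding six by (rule mean_close)
  then have "\<bar>(b (i + 1) - b (i - 1)) / 2 - h\<^sup>2 * d\<bar> \<le> h\<^sup>2 * (\<Lambda> * (6 * h + \<tau>))"
    by simp
  from fin[OF this] show "\<bar>cell_flux \<psi> h (r * h) n i - r / 2 * (b (i + 1) - b (i - 1))\<bar> \<le> (7 + 2 * R) * \<Lambda> * r * h^3"
    by (simp add: X_def \<tau>_def)
qed

lemma time_cell_mass:
  assumes "h > 0" "\<tau> > 0"
  shows "integral (cbox (of_int i * h - h/2, real n * \<tau>) (of_int i * h + h/2, real (Suc n) * \<tau>)) (partial_t \<psi>)
       = cell_mass \<psi> h (real (Suc n) * \<tau>) i - cell_mass \<psi> h (real n * \<tau>) i"
proof -
  let ?a = "of_int i * h - h/2" and ?b = "of_int i * h + h/2"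
  have "integral (cbox (?a, real n * \<tau>) (?b, real (Suc n) * \<tau>)) (partial_t \<psi>)
      = integral {?a..?b} (\<lambda>x. integral {real n * \<tau>..real (Suc n) * \<tau>} (\<lambda>t. partial_t \<psi> (x, t)))"
    using integral_prod_continuous[OF continuous_on_subset[OF cont_t]] by simp
  also have "\<dots> = integral {?a..?b} (\<lambda>x. \<psi> (x, real (Suc n) * \<tau>) - \<psi> (x, real n * \<tau>))"
  proof (rule integral_cong)
    fix x
    have "((\<lambda>t. partial_t \<psi> (x, t)) has_integral (\<psi> (x, real (Suc n) * \<tau>) - \<psi> (x, real n * \<tau>)))
            {real n * \<tau>..real (Suc n) * \<tau>}"
      using assms deriv_t
      by (intro fundamental_theorem_of_calculus)
        (auto simp: has_real_derivative_iff_has_vector_derivative[symmetric] intro: has_field_derivative_at_within)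
    then show "integral {real n * \<tau>..real (Suc n) * \<tau>} (\<lambda>t. partial_t \<psi> (x, t))
        = \<psi> (x, real (Suc n) * \<tau>) - \<psi> (x, real n * \<tau>)"
      by (rule integral_unique)
  qed
  also have "\<dots> = cell_mass \<psi> h (real (Suc n) * \<tau>) i - cell_mass \<psi> h (real n * \<tau>) i"
    unfolding cell_mass_def by (intro integral_diff integrable_continuous_real continuous_slice)
  finally show ?thesis .
qed

lemma cell_mass_vanish:
  assumes "h > 0" and "t \<le> 0 \<or> T \<le> t \<or> M + h \<le> \<bar>of_int i\<bar> * h"
  shows "cell_mass \<psi> h t i = 0"
proof -
  have "\<psi> (x, t) = 0" if "x \<in> {of_int i * h - h/2..of_int i * h + h/2}" for x
  proof -
    have "\<bar>of_int i\<bar> * h = \<bar>of_int i * h\<bar>"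
      using assms(1) by (simp add: abs_mult)
    then have "t \<le> 0 \<or> T \<le> t \<or> M \<le> \<bar>x\<bar>"
      using assms that by auto
    then show ?thesis
      using vanish[of x t] by blast
  qed
  then show ?thesis
    unfolding cell_mass_def by (rule trans[OF integral_cong[where g = "\<lambda>_. 0"]]) simp_all
qed

text \<open>The last time slab may stick out of the strip and the window \<open>{-K..K}\<close> is wider than the support
  of \<open>\<psi>\<close>; both are harmless because the derivatives of \<open>\<psi>\<close> vanish there.\<close>

lemma weak_form_eq_sum:
  assumes h: "h > 0" and \<tau>: "\<tau> = r * h" "r > 0"
    and N: "T \<le> real N * \<tau>" and K: "M + h \<le> of_int K * h"
  shows "weak_form T (step_function h r w) (step_function h r \<phi>) (step_function h r g) \<psi>
     = (\<Sum>n<N. \<Sum>i\<in>{-K..K}.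
          w n i * (cell_mass \<psi> h (real (Suc n) * \<tau>) i - cell_mass \<psi> h (real n * \<tau>) i)
          + (w n i * \<phi> n i - g n i) * cell_flux \<psi> h \<tau> n i)"
proof -
  define Q where "Q n i = {of_int i * h - h/2..<of_int i * h + h/2} \<times> {real n * \<tau>..<real (Suc n) * \<tau>}"
    for n i
  have \<tau>0: "\<tau> > 0"
    using h \<tau> by simp
  have Q: "(x, t) \<in> Q n i \<longleftrightarrow> i = \<lfloor>x / h + 1/2\<rfloor> \<and> int n = \<lfloor>t / \<tau>\<rfloor>" for x t n i
  proof -
    have "i = \<lfloor>x / h + 1/2\<rfloor> \<longleftrightarrow> of_int i \<le> x / h + 1/2 \<and> x / h + 1/2 < of_int i + 1"
      by (metis floor_eq_iff)
    also have "\<dots> \<longleftrightarrow> of_int i * h - h/2 \<le> x \<and> x < of_int i * h + h/2"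
      using h by (simp add: field_simps)
    moreover have "int n = \<lfloor>t / \<tau>\<rfloor> \<longleftrightarrow> real n \<le> t / \<tau> \<and> t / \<tau> < real n + 1"
      by (metis floor_eq_iff of_int_of_nat_eq)
    moreover have "\<dots> \<longleftrightarrow> real n * \<tau> \<le> t \<and> t < real (Suc n) * \<tau>"
      using \<tau>0 by (simp add: field_simps)
    ultimately show ?thesis
      by (auto simp: Q_def)
  qed
  let ?G = "\<lambda>z. \<Sum>n<N. \<Sum>i\<in>{-K..K}. w n i * (indicator (Q n i) z * partial_t \<psi> z)
              + (w n i * \<phi> n i - g n i) * (indicator (Q n i) z * partial_x \<psi> z)"
  have eq: "indicator (UNIV \<times> {0<..<T}) z *\<^sub>R
      (step_function h r w z * partial_t \<psi> z
        + step_function h r w z * step_function h r \<phi> z * partial_x \<psi> z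
        - step_function h r g z * partial_x \<psi> z) = ?G z" for z
  proof (cases z)
    case (Pair x t)
    show ?thesis
    proof (cases "\<bar>x\<bar> \<ge> M \<or> t \<le> 0 \<or> t \<ge> T")
      case True
      then show ?thesis
        using vanish[of x t] by (simp add: Pair)
    next
      case False
      define n0 i0 where "n0 = nat \<lfloor>t / \<tau>\<rfloor>" and "i0 = \<lfloor>x / h + 1/2\<rfloor>"
      have "\<lfloor>t / \<tau>\<rfloor> \<ge> 0"
        using False \<tau>0 by simp
      then have ind: "indicator (Q n i) z = (if i = i0 then if n = n0 then 1 else (0::real) else 0)" for n i
        by (auto simp: Pair indicator_def Q n0_def i0_def)
      have "t / \<tau> < real N"
        using False N \<tau>0 by (simp add: field_simps)
      then have n0: "n0 < N"
        using \<open>\<lfloor>t / \<tau>\<rfloor> \<ge> 0\<close> unfolding n0_def by linarith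
      have "x < of_int K * h" "- of_int K * h < x - h"
        using False K h by auto
      then have "x / h < of_int K" "- of_int K < x / h - 1"
        using h by (simp_all add: field_simps)
      then have i0: "i0 \<in> {-K..K}"
        unfolding i0_def atLeastAtMost_iff by linarith
      have "?G z = (\<Sum>n<N. \<Sum>i\<in>{-K..K}. if i = i0 then if n = n0 then
             w n i * partial_t \<psi> z + (w n i * \<phi> n i - g n i) * partial_x \<psi> z else 0 else 0)"
        by (intro sum.cong refl) (simp add: ind)
      also have "\<dots> = w n0 i0 * partial_t \<psi> z + (w n0 i0 * \<phi> n0 i0 - g n0 i0) * partial_x \<psi> z"
        using n0 i0 by (simp add: sum.delta)
      finally show ?thesis
        using False by (simp add: Pair step_function_def n0_def i0_def \<tau> algebra_simps)
    qed
  qed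
  note int = half_open_box_integral[OF cont_t] half_open_box_integral[OF cont_x]
  have "weak_form T (step_function h r w) (step_function h r \<phi>) (step_function h r g) \<psi> = (LINT z|lebesgue. ?G z)"
    unfolding weak_form_def set_lebesgue_integral_def eq ..
  also have "\<dots> = (\<Sum>n<N. \<Sum>i\<in>{-K..K}. w n i * (LINT z|lebesgue. indicator (Q n i) z * partial_t \<psi> z)
              + (w n i * \<phi> n i - g n i) * (LINT z|lebesgue. indicator (Q n i) z * partial_x \<psi> z))"
    unfolding Q_def
    by (simp add: Bochner_Integration.integral_sum Bochner_Integration.integral_add int(1,3)
        Bochner_Integration.integrable_sum)
  also have "\<dots> = (\<Sum>n<N. \<Sum>i\<in>{-K..K}.
          w n i * (cell_mass \<psi> h (real (Suc n) * \<tau>) i - cell_mass \<psi> h (real n * \<tau>) i)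
          + (w n i * \<phi> n i - g n i) * cell_flux \<psi> h \<tau> n i)"
    unfolding Q_def int(2,4) time_cell_mass[OF h \<tau>0] cell_flux_def ..
  finally show ?thesis .
qed

end

section \<open>The weak residual of the scheme\<close>

context bump
begin

text \<open>The error for one fixed mesh. After summation by parts in time each cell contributes
  \<open>\<bar>w\<bar> O(h\<^sup>3) + \<bar>w \<phi>\<bar> O(r h\<^sup>3) + \<bar>g\<bar> O(r h\<^sup>3)\<close>. One factor \<open>h\<close> turns the sums over \<open>i\<close> into the
  controlled norms, at the price of \<open>h powr - \<beta>\<close> for \<open>\<phi>\<close> and \<open>h powr - \<gamma>\<close> for \<open>g\<close>. The at most
  \<open>(T + R)/(r h)\<close> time steps then consume a factor \<open>r h\<close>.\<close>

lemma scheme_residual: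
  assumes h: "0 < h" "h \<le> 1" and r: "0 < r" "r \<le> R" and \<alpha>: "0 \<le> \<alpha>" "\<alpha> < 1/2"
    and step: "\<And>n i. w (Suc n) i = averaging \<alpha> (transport r (\<phi> n) (w n)) i + r / 2 * (g n (i + 1) - g n (i - 1))"
    and cfl: "\<And>n i. real n \<le> T / (r * h) \<Longrightarrow> r * \<bar>\<phi> n i\<bar> \<le> 1"
    and C\<^sub>\<phi>: "\<And>n i. real n \<le> T / (r * h) \<Longrightarrow> h powr \<beta> * \<bar>\<phi> n i\<bar> \<le> C\<^sub>\<phi>"
    and C\<^sub>w: "\<And>n. real n \<le> T / (r * h) \<Longrightarrow> (\<lambda>i. \<bar>w n i\<bar> * h) summable_on UNIV \<and> (\<Sum>\<^sub>\<infinity>i. \<bar>w n i\<bar> * h) \<le> C\<^sub>w"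
    and C\<^sub>g: "\<And>n. real n \<le> T / (r * h) \<Longrightarrow> (\<lambda>i. \<bar>g n i\<bar> * h powr (1 + \<gamma>)) summable_on UNIV
              \<and> (\<Sum>\<^sub>\<infinity>i. \<bar>g n i\<bar> * h powr (1 + \<gamma>)) \<le> C\<^sub>g"
  shows "\<bar>weak_form T (step_function h r w) (step_function h r \<phi>) (step_function h r g) \<psi>\<bar>
    \<le> (T + R) * (2 * \<Lambda> * C\<^sub>w * (h / r) + (7 + 2 * R) * \<Lambda> * C\<^sub>\<phi> * C\<^sub>w * h powr (1 - \<beta>)
                + (7 + 2 * R) * \<Lambda> * C\<^sub>g * h powr (1 - \<gamma>))"
proof -
  define \<tau> where "\<tau> = r * h"
  define N where "N = nat \<lceil>T / \<tau>\<rceil>"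
  \<comment> \<open>The offset 3 is one cell for the overlap of cells with \<open>{-M..M}\<close> plus the margin of two indices in \<open>scheme_step_pairing\<close>.\<close>
  define K where "K = \<lceil>M / h\<rceil> + 3"
  define G where "G = (7 + 2 * R) * \<Lambda>"
  define b where "b n = cell_mass \<psi> h (real n * \<tau>)" for n
  define X where "X = cell_flux \<psi> h \<tau>"
  define \<epsilon> where "\<epsilon> = 2 * \<Lambda> * C\<^sub>w * (h / r) + G * C\<^sub>\<phi> * C\<^sub>w * h powr (1 - \<beta>) + G * C\<^sub>g * h powr (1 - \<gamma>)"
  define E where "E n i = (w n i * \<phi> n i) * (X n i - r * upwind_diff (\<phi> n) (averaging \<alpha> (b (Suc n))) i)
      - w n i * (averaging \<alpha> (b (Suc n)) i - b (Suc n) i)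
      - g n i * (X n i - r / 2 * (b (Suc n) (i + 1) - b (Suc n) (i - 1)))" for n i
  have \<tau>0: "0 < \<tau>" "\<tau> \<le> R"
    using h r mult_mono[of r R h 1] by (auto simp: \<tau>_def)
  have G0: "0 \<le> G"
    using r \<Lambda>_nonneg by (simp add: G_def)
  have C\<phi>0: "0 \<le> C\<^sub>\<phi>"
    using C\<^sub>\<phi>[of 0 0] T_pos h r by (auto intro: order_trans[rotated])
  have Cw0: "0 \<le> C\<^sub>w"
    using C\<^sub>w[of 0] infsum_nonneg[of UNIV "\<lambda>i. \<bar>w 0 i\<bar> * h"] T_pos h r by auto
  have Cg0: "0 \<le> C\<^sub>g"
    using C\<^sub>g[of 0] infsum_nonneg[of UNIV "\<lambda>i. \<bar>g 0 i\<bar> * h powr (1 + \<gamma>)"] T_pos h r by auto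
  have Nge: "T \<le> real N * \<tau>"
  proof -
    have "T / \<tau> \<le> real N"
      unfolding N_def by linarith
    then show ?thesis
      using \<tau>0 by (simp add: field_simps)
  qed
  have ceil_pos: "0 \<le> \<lceil>T / \<tau>\<rceil>"
    using T_pos \<tau>0 by (simp add: less_le_trans[of "-1" 0])
  have Nlt: "real n \<le> T / (r * h)" if "n < N" for n
    using that ceil_pos unfolding N_def \<tau>_def[symmetric] by linarith
  have Nle: "real N * \<tau> \<le> T + R"
  proof -
    have "real N \<le> T / \<tau> + 1"
      using ceil_pos unfolding N_def by linarith
    then have "real N * \<tau> \<le> T + \<tau>"
      using \<tau>0 by (simp add: field_simps)
    then show ?thesis
      using \<tau>0 by simp
  qed
  have K: "M + h \<le> \<bar>of_int i\<bar> * h" if "K - 2 \<le> \<bar>i\<bar>" for i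
  proof -
    have "M / h + 1 \<le> \<bar>of_int i\<bar>"
      using that unfolding K_def by linarith
    then show ?thesis
      using h by (simp add: field_simps)
  qed
  have K': "M + h \<le> of_int K * h"
  proof -
    have "M / h + 1 \<le> of_int K"
      unfolding K_def by linarith
    then show ?thesis
      using h by (simp add: field_simps)
  qed
  have supp: "b n i = 0" if "K - 2 \<le> \<bar>i\<bar>" for n i
    unfolding b_def using K[OF that] h by (intro cell_mass_vanish) auto
  have b0: "b 0 i = 0" and bN: "b N i = 0" for i
    using Nge h by (auto simp: b_def intro: cell_mass_vanish)
  have "weak_form T (step_function h r w) (step_function h r \<phi>) (step_function h r g) \<psi>
      = (\<Sum>n<N. \<Sum>i\<in>{-K..K}. w n i * (b (Suc n) i - b n i) + (w n i * \<phi> n i - g n i) * X n i)"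
    unfolding b_def X_def using h r by (intro weak_form_eq_sum \<tau>_def Nge K') auto
  also have "\<dots> = (\<Sum>n<N. (\<Sum>i\<in>{-K..K}. (w n i * \<phi> n i - g n i) * X n i)
      - (\<Sum>i\<in>{-K..K}. (w (Suc n) i - w n i) * b (Suc n) i))"
    using summation_by_parts[of b N w "{-K..K}", OF b0 bN] by (simp add: sum.distrib sum_subtractf)
  also have "\<dots> = (\<Sum>n<N. \<Sum>i\<in>{-K..K}. E n i)"
  proof (rule sum.cong[OF refl])
    fix n assume "n \<in> {..<N}"
    then have "real n \<le> T / (r * h)"
      using Nlt by simp
    then have *: "(\<Sum>i\<in>{-K..K}. (w (Suc n) i - w n i) * b (Suc n) i)
       = (\<Sum>i\<in>{-K..K}. w n i * (averaging \<alpha> (b (Suc n)) i - b (Suc n) i)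
            + w n i * \<phi> n i * (r * upwind_diff (\<phi> n) (averaging \<alpha> (b (Suc n))) i)
            - g n i * (r / 2 * (b (Suc n) (i + 1) - b (Suc n) (i - 1))))"
      by (intro scheme_step_pairing supp r cfl step)
    show "(\<Sum>i\<in>{-K..K}. (w n i * \<phi> n i - g n i) * X n i)
      - (\<Sum>i\<in>{-K..K}. (w (Suc n) i - w n i) * b (Suc n) i) = (\<Sum>i\<in>{-K..K}. E n i)"
      unfolding * sum_subtractf[symmetric]
      by (intro sum.cong refl) (simp add: E_def algebra_simps)
  qed
  finally have weak: "weak_form T (step_function h r w) (step_function h r \<phi>) (step_function h r g) \<psi>
      = (\<Sum>n<N. \<Sum>i\<in>{-K..K}. E n i)" .
  have row: "\<bar>\<Sum>i\<in>{-K..K}. E n i\<bar> \<le> \<tau> * \<epsilon>" if "n < N" for n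
  proof -
    note n = Nlt[OF that]
    let ?a = "2 * \<Lambda> * h^2 + G * C\<^sub>\<phi> * \<tau> * h powr (1 - \<beta>)" and ?c = "G * \<tau> * h powr (1 - \<gamma>)"
    have Ebound: "\<bar>E n i\<bar> \<le> ?a * (\<bar>w n i\<bar> * h) + ?c * (\<bar>g n i\<bar> * h powr (1 + \<gamma>))" for i
    proof -
      have p: "h powr (1 - \<beta>) = h * h powr (-\<beta>)" "h powr (1 - \<gamma>) * h powr (1 + \<gamma>) = h * h"
        using h powr_add[of h 1 "-\<beta>"] powr_add[of h "1 - \<gamma>" "1 + \<gamma>"] by (auto simp: power2_eq_square)
      have "h powr (-\<beta>) * (h powr \<beta> * \<bar>\<phi> n i\<bar>) \<le> h powr (-\<beta>) * C\<^sub>\<phi>"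
        by (intro mult_left_mono C\<^sub>\<phi> n) simp
      then have \<phi>: "\<bar>\<phi> n i\<bar> \<le> h powr (-\<beta>) * C\<^sub>\<phi>"
        using h by (simp add: mult.assoc[symmetric] powr_add[symmetric])
      have x1: "\<bar>X n i - r * upwind_diff (\<phi> n) (averaging \<alpha> (b (Suc n))) i\<bar> \<le> G * r * h^3"
        and x2: "\<bar>X n i - r / 2 * (b (Suc n) (i + 1) - b (Suc n) (i - 1))\<bar> \<le> G * r * h^3"
        and x3: "\<bar>averaging \<alpha> (b (Suc n)) i - b (Suc n) i\<bar> \<le> 2 * \<Lambda> * h^3"
        unfolding G_def X_def b_def \<tau>_def
        using flux_consistent[OF h(1) r \<alpha>, of n] averaging_cell_mass[OF h(1) \<alpha>] by simp_all
      have "\<bar>E n i\<bar> \<le> (\<bar>w n i\<bar> * \<bar>\<phi> n i\<bar>) * \<bar>X n i - r * upwind_diff (\<phi> n) (averaging \<alpha> (b (Suc n))) i\<bar>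
          + \<bar>w n i\<bar> * \<bar>averaging \<alpha> (b (Suc n)) i - b (Suc n) i\<bar>
          + \<bar>g n i\<bar> * \<bar>X n i - r / 2 * (b (Suc n) (i + 1) - b (Suc n) (i - 1))\<bar>"
        unfolding E_def abs_mult[symmetric]
        by (intro order_trans[OF abs_triangle_ineq4] add_right_mono abs_triangle_ineq4)
      also have "\<dots> \<le> (\<bar>w n i\<bar> * (h powr (-\<beta>) * C\<^sub>\<phi>)) * (G * r * h^3) + \<bar>w n i\<bar> * (2 * \<Lambda> * h^3) + \<bar>g n i\<bar> * (G * r * h^3)"
        using C\<phi>0 by (intro add_mono mult_mono \<phi> x1 x2 x3 order_refl) auto
      also have "\<dots> = ?a * (\<bar>w n i\<bar> * h) + G * \<tau> * \<bar>g n i\<bar> * (h * h)"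
        unfolding p(1) \<tau>_def by (simp add: power2_eq_square power3_eq_cube algebra_simps)
      also have "\<dots> = ?a * (\<bar>w n i\<bar> * h) + ?c * (\<bar>g n i\<bar> * h powr (1 + \<gamma>))"
        unfolding p(2)[symmetric] by (simp add: mult_ac)
      finally show ?thesis .
    qed
    have sw: "(\<Sum>i\<in>{-K..K}. \<bar>w n i\<bar> * h) \<le> C\<^sub>w"
      using C\<^sub>w[OF n] h finite_sum_le_infsum[of "\<lambda>i. \<bar>w n i\<bar> * h" UNIV "{-K..K}"] by auto
    have sg: "(\<Sum>i\<in>{-K..K}. \<bar>g n i\<bar> * h powr (1 + \<gamma>)) \<le> C\<^sub>g"
      using C\<^sub>g[OF n] h finite_sum_le_infsum[of "\<lambda>i. \<bar>g n i\<bar> * h powr (1 + \<gamma>)" UNIV "{-K..K}"] by auto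
    have "\<bar>\<Sum>i\<in>{-K..K}. E n i\<bar> \<le> (\<Sum>i\<in>{-K..K}. ?a * (\<bar>w n i\<bar> * h) + ?c * (\<bar>g n i\<bar> * h powr (1 + \<gamma>)))"
      by (intro order_trans[OF sum_abs] sum_mono Ebound)
    also have "\<dots> = ?a * (\<Sum>i\<in>{-K..K}. \<bar>w n i\<bar> * h) + ?c * (\<Sum>i\<in>{-K..K}. \<bar>g n i\<bar> * h powr (1 + \<gamma>))"
      by (simp only: sum.distrib sum_distrib_left)
    also have "\<dots> \<le> ?a * C\<^sub>w + ?c * C\<^sub>g"
      using \<Lambda>_nonneg G0 C\<phi>0 \<tau>0 by (intro add_mono mult_left_mono sw sg) auto
    also have "\<dots> = \<tau> * \<epsilon>"
      using r by (simp add: \<epsilon>_def \<tau>_def power2_eq_square field_simps)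
    finally show ?thesis .
  qed
  have "\<bar>\<Sum>n<N. \<Sum>i\<in>{-K..K}. E n i\<bar> \<le> (\<Sum>n<N. \<tau> * \<epsilon>)"
    by (intro order_trans[OF sum_abs] sum_mono row) simp
  also have "\<dots> = (real N * \<tau>) * \<epsilon>"
    by simp
  also have "\<dots> \<le> (T + R) * \<epsilon>"
    using \<Lambda>_nonneg G0 C\<phi>0 Cw0 Cg0 h r by (intro mult_right_mono Nle) (simp add: \<epsilon>_def)
  finally show ?thesis
    unfolding weak \<epsilon>_def G_def .
qed

end

text \<open>For the Lipschitz bound: the derivative of \<open>\<psi>\<^sub>x\<close> is continuous with compact
  support, hence bounded, and the mean value inequality gives the Lipschitz constant.\<close>

lemma test_function_bump:
  fixes \<psi> :: "real \<times> real \<Rightarrow> real"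
  assumes \<psi>: "\<psi> \<in> test_functions (UNIV \<times> {0<..<T})" and T: "T > 0"
  shows "\<exists>\<Lambda> M. bump \<psi> \<Lambda> M T"
proof -
  define S where "S = closure {z. \<psi> z \<noteq> 0}"
  define D where "D w z = frechet_derivative \<psi> (at z) w" for w z
  define H where "H v z = frechet_derivative (D (1, 0)) (at z) v" for v z
  have C2: "C_k_diff (Suc (Suc 0)) \<psi>" and cpt: "compact S" and sub: "S \<subseteq> UNIV \<times> {0<..<T}"
    using \<psi> by (auto simp: test_functions_def smooth_def S_def)
  then have d1: "\<psi> differentiable (at z)" and d2: "D w differentiable (at z)"
    and cH: "continuous_on UNIV (H v)" for z w v
    unfolding C_k_diff.simps D_def[abs_def] H_def[abs_def] by blast+
  have der: "(\<psi> has_derivative (\<lambda>w. D w z)) (at z)" for z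
    using d1 by (simp add: D_def[abs_def] frechet_derivative_works[symmetric])
  have derD: "(D (1, 0) has_derivative (\<lambda>v. H v z)) (at z)" for z
    using d2 by (simp add: H_def[abs_def] frechet_derivative_works[symmetric])
  have cD: "continuous_on UNIV (D w)" for w
    using d2 by (simp add: continuous_on_eq_continuous_within differentiable_imp_continuous_within)
  have zero: "\<psi> z = 0" if "z \<notin> S" for z
    using that closure_subset[of "{z. \<psi> z \<noteq> 0}"] by (auto simp: S_def)
  have op: "open (- S)"
    by (auto simp: S_def)
  have D0: "D w z = 0" if "z \<notin> S" for w z
  proof -
    have "(\<psi> has_derivative (\<lambda>_. 0)) (at z)"
      by (rule has_derivative_transform_within_open[where f = "\<lambda>_. 0", OF has_derivative_const op])
        (use that zero in auto)
    from fun_cong[OF has_derivative_unique[OF der this], of w] show ?thesis .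
  qed
  have H0: "H v z = 0" if "z \<notin> S" for v z
  proof -
    have "(D (1, 0) has_derivative (\<lambda>_. 0)) (at z)"
      by (rule has_derivative_transform_within_open[where f = "\<lambda>_. 0", OF has_derivative_const op])
        (use that D0 in auto)
    from fun_cong[OF has_derivative_unique[OF derD this], of v] show ?thesis .
  qed
  have px: "((\<lambda>y. \<psi> (y, t)) has_real_derivative D (1, 0) (x, t)) (at x)" for x t
  proof -
    have "((\<lambda>y. \<psi> (y, t)) has_derivative (\<lambda>e. D (e, 0) (x, t))) (at x)"
      by (rule has_derivative_compose[where f = "\<lambda>y. (y, t)", OF _ der]) (auto intro!: derivative_eq_intros)
    moreover have "(\<lambda>e. D (e, 0) (x, t)) = (*) (D (1, 0) (x, t))"
    proof
      fix e
      show "D (e, 0) (x, t) = D (1, 0) (x, t) * e"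
        using linear_cmul[OF has_derivative_linear[OF der[of "(x, t)"]], of e "(1, 0)"] by simp
    qed
    ultimately show ?thesis
      unfolding has_field_derivative_def by simp
  qed
  have pt: "((\<lambda>s. \<psi> (x, s)) has_real_derivative D (0, 1) (x, t)) (at t)" for x t
  proof -
    have "((\<lambda>s. \<psi> (x, s)) has_derivative (\<lambda>e. D (0, e) (x, t))) (at t)"
      by (rule has_derivative_compose[where f = "\<lambda>s. (x, s)", OF _ der]) (auto intro!: derivative_eq_intros)
    moreover have "(\<lambda>e. D (0, e) (x, t)) = (*) (D (0, 1) (x, t))"
    proof
      fix e
      show "D (0, e) (x, t) = D (0, 1) (x, t) * e"
        using linear_cmul[OF has_derivative_linear[OF der[of "(x, t)"]], of e "(0, 1)"] by simp
    qed
    ultimately show ?thesis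
      unfolding has_field_derivative_def by simp
  qed
  have eqx: "partial_x \<psi> = D (1, 0)" and eqt: "partial_t \<psi> = D (0, 1)"
    using DERIV_imp_deriv[OF px] DERIV_imp_deriv[OF pt]
    by (auto simp: partial_x_def partial_t_def fun_eq_iff)
  have "\<exists>B. \<forall>z. \<bar>H v z\<bar> \<le> B" for v
  proof -
    have "bounded (H v ` S)"
      by (intro compact_imp_bounded compact_continuous_image continuous_on_subset[OF cH] cpt) auto
    then obtain B where "\<forall>z\<in>S. \<bar>H v z\<bar> \<le> B"
      by (auto simp: bounded_iff)
    then have "\<bar>H v z\<bar> \<le> max B 0" for z
      using H0[of z v] by (cases "z \<in> S") (auto simp: le_max_iff_disj)
    then show ?thesis
      by blast
  qed
  then obtain B1 B2 where B1: "\<And>z. \<bar>H (1, 0) z\<bar> \<le> B1" and B2: "\<And>z. \<bar>H (0, 1) z\<bar> \<le> B2"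
    by metis
  have on: "onorm (\<lambda>v. H v z) \<le> B1 + B2" for z
  proof (rule onorm_le)
    fix v :: "real \<times> real"
    obtain a c where v: "v = (a, c)"
      by (cases v)
    have lin: "linear (\<lambda>v. H v z)"
      by (rule has_derivative_linear[OF derD])
    have "v = a *\<^sub>R (1, 0) + c *\<^sub>R (0, 1)"
      by (simp add: v)
    then have "H v z = a * H (1, 0) z + c * H (0, 1) z"
      using linear_add[OF lin] linear_cmul[OF lin] by (metis real_scaleR_def)
    then have "\<bar>H v z\<bar> \<le> \<bar>a\<bar> * \<bar>H (1, 0) z\<bar> + \<bar>c\<bar> * \<bar>H (0, 1) z\<bar>"
      by (simp add: abs_mult[symmetric])
    also have "\<dots> \<le> norm v * B1 + norm v * B2"
      using norm_fst_le[of a c] norm_snd_le[of c a] by (intro add_mono mult_mono B1 B2) (auto simp: v)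
    finally show "norm (H v z) \<le> (B1 + B2) * norm v"
      by (simp add: algebra_simps)
  qed
  have B0: "0 \<le> B1 + B2"
    using B1[of 0] B2[of 0] by linarith
  have lip: "\<bar>D (1, 0) (x, t) - D (1, 0) (y, s)\<bar> \<le> (B1 + B2) * (\<bar>x - y\<bar> + \<bar>t - s\<bar>)" for x t y s
  proof -
    have "norm (D (1, 0) (x, t) - D (1, 0) (y, s)) \<le> (B1 + B2) * norm ((x, t) - (y, s))"
      by (rule differentiable_bound[OF convex_UNIV]) (auto intro: derD on)
    also have "\<dots> \<le> (B1 + B2) * (\<bar>x - y\<bar> + \<bar>t - s\<bar>)"
      using B0 norm_Pair_le[of "x - y" "t - s"] by (intro mult_left_mono) auto
    finally show ?thesis by simp
  qed
  obtain m where m: "\<And>z. z \<in> S \<Longrightarrow> norm z \<le> m"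
    using compact_imp_bounded[OF cpt] by (auto simp: bounded_iff)
  have van: "(x, t) \<notin> S" if "\<bar>x\<bar> \<ge> m + 1 \<or> t \<le> 0 \<or> t \<ge> T" for x t
    using that m[of "(x, t)"] norm_fst_le[of x t] sub by force
  have "bump \<psi> (B1 + B2) (m + 1) T"
    using T px pt cD lip van zero D0 by unfold_locales (auto simp: eqx eqt)
  then show ?thesis
    by blast
qed

lemma eventually_bound_imp_tendsto_bigo:
  fixes I E :: "nat \<Rightarrow> real"
  assumes bound: "\<forall>\<^sub>F k in sequentially. \<bar>I k\<bar> \<le> C * E k" and pos: "\<And>k. 0 \<le> E k" and E: "E \<longlonglongrightarrow> 0"
  shows "I \<longlonglongrightarrow> 0 \<and> I \<in> O[sequentially](E)"
proof
  show "I \<in> O[sequentially](E)"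
    using bound pos by (intro bigoI[of _ C]) simp
  show "I \<longlonglongrightarrow> 0"
    by (rule Lim_null_comparison[of _ "\<lambda>k. C * E k"])
      (use bound tendsto_mult_left[OF E, of C] in auto)
qed

lemma (in bump) scheme_residual_sequence:
  fixes h r :: "nat \<Rightarrow> real" and w \<phi> g :: "nat \<Rightarrow> nat \<Rightarrow> int \<Rightarrow> real"
  assumes h: "\<And>k. h k > 0" "h \<longlonglongrightarrow> 0" and r: "\<And>k. r k > 0" "Bseq r"
    and \<alpha>: "0 \<le> \<alpha>" "\<alpha> < 1/2" and \<beta>: "\<beta> < 1" and \<gamma>: "\<gamma> < 1"
    and a: "(\<lambda>k. h k / r k) \<longlonglongrightarrow> 0"
    and step: "\<And>k n i. w k (Suc n) i = averaging \<alpha> (transport (r k) (\<phi> k n) (w k n)) i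
                 + r k / 2 * (g k n (i + 1) - g k n (i - 1))"
    and b: "\<forall>\<^sub>F k in sequentially. \<forall>n i. real n \<le> T / (r k * h k) \<longrightarrow> r k * \<bar>\<phi> k n i\<bar> \<le> 1"
    and c: "\<exists>C. \<forall>\<^sub>F k in sequentially. \<forall>n i. real n \<le> T / (r k * h k) \<longrightarrow> h k powr \<beta> * \<bar>\<phi> k n i\<bar> \<le> C"
    and d: "\<exists>C. \<forall>\<^sub>F k in sequentially. \<forall>n. real n \<le> T / (r k * h k) \<longrightarrow>
              (\<lambda>i. \<bar>w k n i\<bar> * h k) summable_on UNIV \<and> (\<Sum>\<^sub>\<infinity>i. \<bar>w k n i\<bar> * h k) \<le> C"
    and e: "\<exists>C. \<forall>\<^sub>F k in sequentially. \<forall>n. real n \<le> T / (r k * h k) \<longrightarrow>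
              (\<lambda>i. \<bar>g k n i\<bar> * h k powr (1 + \<gamma>)) summable_on UNIV \<and>
              (\<Sum>\<^sub>\<infinity>i. \<bar>g k n i\<bar> * h k powr (1 + \<gamma>)) \<le> C"
  defines "I \<equiv> \<lambda>k. weak_form T (step_function (h k) (r k) (w k)) (step_function (h k) (r k) (\<phi> k))
              (step_function (h k) (r k) (g k)) \<psi>"
    and "E \<equiv> \<lambda>k. h k / r k + h k powr (1 - \<beta>) + h k powr (1 - \<gamma>)"
  shows "I \<longlonglongrightarrow> 0 \<and> I \<in> O[sequentially](E)"
proof -
  obtain R where R: "R > 0" "\<And>k. r k \<le> R"
    using r(2) by (auto simp: Bseq_def abs_le_iff)
  obtain C\<^sub>\<phi> where C\<^sub>\<phi>: "\<forall>\<^sub>F k in sequentially. \<forall>n i. real n \<le> T / (r k * h k) \<longrightarrow> h k powr \<beta> * \<bar>\<phi> k n i\<bar> \<le> C\<^sub>\<phi>"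
    using c by blast
  obtain C\<^sub>w where C\<^sub>w: "\<forall>\<^sub>F k in sequentially. \<forall>n. real n \<le> T / (r k * h k) \<longrightarrow>
              (\<lambda>i. \<bar>w k n i\<bar> * h k) summable_on UNIV \<and> (\<Sum>\<^sub>\<infinity>i. \<bar>w k n i\<bar> * h k) \<le> C\<^sub>w"
    using d by blast
  obtain C\<^sub>g where C\<^sub>g: "\<forall>\<^sub>F k in sequentially. \<forall>n. real n \<le> T / (r k * h k) \<longrightarrow>
              (\<lambda>i. \<bar>g k n i\<bar> * h k powr (1 + \<gamma>)) summable_on UNIV \<and>
              (\<Sum>\<^sub>\<infinity>i. \<bar>g k n i\<bar> * h k powr (1 + \<gamma>)) \<le> C\<^sub>g"
    using e by blast
  \<comment> \<open>Absolute values are taken since the signs of the bounds obtained from the hypotheses are unknown here.\<close>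
  define c\<^sub>1 c\<^sub>2 c\<^sub>3 where "c\<^sub>1 = 2 * \<Lambda> * C\<^sub>w" and "c\<^sub>2 = (7 + 2 * R) * \<Lambda> * C\<^sub>\<phi> * C\<^sub>w" and "c\<^sub>3 = (7 + 2 * R) * \<Lambda> * C\<^sub>g"
  define c where "c = \<bar>c\<^sub>1\<bar> + \<bar>c\<^sub>2\<bar> + \<bar>c\<^sub>3\<bar>"
  have le_c: "c\<^sub>1 \<le> c" "c\<^sub>2 \<le> c" "c\<^sub>3 \<le> c"
    by (auto simp: c_def)
  have nonneg: "0 \<le> h k / r k" "0 \<le> h k powr (1 - \<beta>)" "0 \<le> h k powr (1 - \<gamma>)" for k
    using h(1)[of k] r(1)[of k] by simp_all
  have small: "\<forall>\<^sub>F k in sequentially. h k < 1"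
    using h(2) by (rule order_tendstoD) simp
  have "\<forall>\<^sub>F k in sequentially. \<bar>I k\<bar> \<le> (T + R) * c * E k"
    using small b C\<^sub>\<phi> C\<^sub>w C\<^sub>g
  proof eventually_elim
    case (elim k)
    have "\<bar>I k\<bar> \<le> (T + R) * (c\<^sub>1 * (h k / r k) + c\<^sub>2 * h k powr (1 - \<beta>) + c\<^sub>3 * h k powr (1 - \<gamma>))"
      unfolding I_def c\<^sub>1_def c\<^sub>2_def c\<^sub>3_def
      by (rule scheme_residual[where \<alpha> = \<alpha>])
        (use elim h(1) r(1) R \<alpha> step in \<open>auto intro: less_imp_le\<close>)
    also have "\<dots> \<le> (T + R) * (c * (h k / r k) + c * h k powr (1 - \<beta>) + c * h k powr (1 - \<gamma>))"
      using T_pos R nonneg[of k] by (intro mult_left_mono add_mono mult_right_mono le_c) auto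
    also have "\<dots> = (T + R) * c * E k"
      unfolding E_def by (simp only: distrib_left mult.assoc)
    finally show ?case .
  qed
  moreover have "E \<longlonglongrightarrow> 0"
  proof -
    have "(\<lambda>k. h k powr p) \<longlonglongrightarrow> 0" if "p > 0" for p
    proof -
      have "(\<lambda>k. h k powr p) \<longlonglongrightarrow> 0 powr p"
        by (rule tendsto_powr'[OF h(2) tendsto_const]) (use that h(1) in \<open>simp add: less_imp_le\<close>)
      then show ?thesis
        by simp
    qed
    from a this[of "1 - \<beta>"] this[of "1 - \<gamma>"] show ?thesis
      unfolding E_def using \<beta> \<gamma> by (auto intro!: tendsto_add_zero)
  qed
  moreover have "0 \<le> E k" for k
    unfolding E_def using nonneg[of k] by simp
  ultimately show ?thesis
    by (intro eventually_bound_imp_tendsto_bigo)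
qed

section \<open>The system\<close>

theorem mainTheorem1:
  fixes \<Phi> A B :: "real \<times> real \<Rightarrow> real"
    and T \<alpha> \<beta> \<gamma> :: real
    and u0 v0 :: "real \<Rightarrow> real"
    and h r :: "nat \<Rightarrow> real"
    and u v :: "nat \<Rightarrow> nat \<Rightarrow> int \<Rightarrow> real"
    and uh vh :: "nat \<Rightarrow> real \<times> real \<Rightarrow> real"
  assumes "T > 0" and "0 \<le> \<alpha>" and "\<alpha> < 1/2"
    and "integrable lebesgue u0" and "integrable lebesgue v0"
    and "\<And>k. h k > 0" and "h \<longlonglongrightarrow> 0"
    and "\<And>k. r k > 0" and "Bseq r"
    and scheme: "\<And>k n. (u k n, v k n) = scheme (h k) (r k) \<alpha> \<Phi> A B u0 v0 n"
    and uh: "\<And>k. uh k = step_function (h k) (r k) (u k)"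
    and vh: "\<And>k. vh k = step_function (h k) (r k) (v k)"
    and "0 \<le> \<beta>" and "\<beta> < 1" and "0 \<le> \<gamma>" and "\<gamma> < 1"
    and a: "(\<lambda>k. h k / r k) \<longlonglongrightarrow> 0"
    and b: "\<forall>\<^sub>F k in sequentially. \<forall>n i. real n \<le> T / (r k * h k) \<longrightarrow>
              r k * \<bar>\<Phi> (u k n i, v k n i)\<bar> \<le> 1"
    and c: "\<exists>C. \<forall>\<^sub>F k in sequentially. \<forall>n i. real n \<le> T / (r k * h k) \<longrightarrow>
              h k powr \<beta> * \<bar>\<Phi> (u k n i, v k n i)\<bar> \<le> C"
    and d_u: "\<exists>C. \<forall>\<^sub>F k in sequentially. \<forall>n. real n \<le> T / (r k * h k) \<longrightarrow>
              (\<lambda>i. \<bar>u k n i\<bar> * h k) summable_on UNIV \<and>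
              (\<Sum>\<^sub>\<infinity>i. \<bar>u k n i\<bar> * h k) \<le> C"
    and d_v: "\<exists>C. \<forall>\<^sub>F k in sequentially. \<forall>n. real n \<le> T / (r k * h k) \<longrightarrow>
              (\<lambda>i. \<bar>v k n i\<bar> * h k) summable_on UNIV \<and>
              (\<Sum>\<^sub>\<infinity>i. \<bar>v k n i\<bar> * h k) \<le> C"
    and e_A: "\<exists>C. \<forall>\<^sub>F k in sequentially. \<forall>n. real n \<le> T / (r k * h k) \<longrightarrow>
              (\<lambda>i. \<bar>A (u k n i, v k n i)\<bar> * h k powr (1 + \<gamma>)) summable_on UNIV \<and>
              (\<Sum>\<^sub>\<infinity>i. \<bar>A (u k n i, v k n i)\<bar> * h k powr (1 + \<gamma>)) \<le> C"
    and e_B: "\<exists>C. \<forall>\<^sub>F k in sequentially. \<forall>n. real n \<le> T / (r k * h k) \<longrightarrow>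
              (\<lambda>i. \<bar>B (u k n i, v k n i)\<bar> * h k powr (1 + \<gamma>)) summable_on UNIV \<and>
              (\<Sum>\<^sub>\<infinity>i. \<bar>B (u k n i, v k n i)\<bar> * h k powr (1 + \<gamma>)) \<le> C"
  shows "\<forall>\<psi> \<in> test_functions (UNIV \<times> {0<..<T}).
    (let I = (\<lambda>k. weak_form T (uh k) (\<lambda>z. \<Phi> (uh k z, vh k z)) (\<lambda>z. A (uh k z, vh k z)) \<psi>);
         J = (\<lambda>k. weak_form T (vh k) (\<lambda>z. \<Phi> (uh k z, vh k z)) (\<lambda>z. B (uh k z, vh k z)) \<psi>);
         E = (\<lambda>k. h k / r k + h k powr (1 - \<beta>) + h k powr (1 - \<gamma>))
     in I \<longlonglongrightarrow> 0 \<and> J \<longlonglongrightarrow> 0 \<and> I \<in> O[sequentially](E) \<and> J \<in> O[sequentially](E))"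
proof
  fix \<psi> :: "real \<times> real \<Rightarrow> real"
  assume \<psi>: "\<psi> \<in> test_functions (UNIV \<times> {0<..<T})"
  obtain \<Lambda> M where "bump \<psi> \<Lambda> M T"
    using test_function_bump[OF \<psi> \<open>T > 0\<close>] by blast
  then interpret bump \<psi> \<Lambda> M T .
  have step: "(u k (Suc n), v k (Suc n)) = scheme_step (r k) \<alpha> \<Phi> A B (u k n, v k n)" for k n
    unfolding scheme by simp
  have comp: "(\<lambda>z. F (uh k z, vh k z)) = step_function (h k) (r k) (\<lambda>n i. F (u k n i, v k n i))"
    for F :: "real \<times> real \<Rightarrow> real" and k
    by (auto simp: uh vh step_function_def)
  note residual = scheme_residual_sequence[where h = h and r = r and \<alpha> = \<alpha> and \<beta> = \<beta> and \<gamma> = \<gamma>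
      and \<phi> = "\<lambda>k n i. \<Phi> (u k n i, v k n i)",
      OF assms(6,7,8,9) assms(2,3) \<open>\<beta> < 1\<close> \<open>\<gamma> < 1\<close> a]
  have "(\<lambda>k. weak_form T (uh k) (\<lambda>z. \<Phi> (uh k z, vh k z)) (\<lambda>z. A (uh k z, vh k z)) \<psi>) \<longlonglongrightarrow> 0 \<and>
     (\<lambda>k. weak_form T (uh k) (\<lambda>z. \<Phi> (uh k z, vh k z)) (\<lambda>z. A (uh k z, vh k z)) \<psi>)
       \<in> O[sequentially](\<lambda>k. h k / r k + h k powr (1 - \<beta>) + h k powr (1 - \<gamma>))"
    unfolding comp unfolding uh
    by (rule residual[where w = u and g = "\<lambda>k n i. A (u k n i, v k n i)"])
      (use step b c d_u e_A in \<open>auto simp: scheme_step_def Let_def\<close>)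
  moreover have "(\<lambda>k. weak_form T (vh k) (\<lambda>z. \<Phi> (uh k z, vh k z)) (\<lambda>z. B (uh k z, vh k z)) \<psi>) \<longlonglongrightarrow> 0 \<and>
     (\<lambda>k. weak_form T (vh k) (\<lambda>z. \<Phi> (uh k z, vh k z)) (\<lambda>z. B (uh k z, vh k z)) \<psi>)
       \<in> O[sequentially](\<lambda>k. h k / r k + h k powr (1 - \<beta>) + h k powr (1 - \<gamma>))"
    unfolding comp unfolding vh
    by (rule residual[where w = v and g = "\<lambda>k n i. B (u k n i, v k n i)"])
      (use step b c d_v e_B in \<open>auto simp: scheme_step_def Let_def\<close>)
  ultimately show "let I = (\<lambda>k. weak_form T (uh k) (\<lambda>z. \<Phi> (uh k z, vh k z)) (\<lambda>z. A (uh k z, vh k z)) \<psi>);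
         J = (\<lambda>k. weak_form T (vh k) (\<lambda>z. \<Phi> (uh k z, vh k z)) (\<lambda>z. B (uh k z, vh k z)) \<psi>);
         E = (\<lambda>k. h k / r k + h k powr (1 - \<beta>) + h k powr (1 - \<gamma>))
     in I \<longlonglongrightarrow> 0 \<and> J \<longlonglongrightarrow> 0 \<and> I \<in> O[sequentially](E) \<and> J \<in> O[sequentially](E)"
    unfolding Let_def by blast
qed

end
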